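(* Let $(n_{k})_{k\ge 0}$ be the sequence obtained by ordering the set $F=\{2^{k}3^{k'} : k,k'\ge 0\}$ in a strictly increasing fashion. For every finite complex Borel measure $\nu$ on $\mathbb{T}$ such that $\mathrm{Re}\,\widehat{\nu}(1)<1/2$, the set $W((n_{k})_{k\ge 0},\nu)$ is uncountable.
   Context: $\mathbb{T}=\{\lambda\in\mathbb{C} : |\lambda|=1\}$. For a finite complex Borel measure $\nu$ on $\mathbb{T}$ and $n\in\mathbb{Z}$, $\widehat{\nu}(n)=\int_{\mathbb{T}}\lambda^{n}\,d\nu(\lambda)$. Given a strictly increasing sequence of integers $(n_{k})_{k\ge 0}$, a finite complex Borel measure $\nu$ on $\mathbb{T}$ and $\theta\in\mathbb{R}$, the sequence $(n_{k}\theta)_{k\ge 0}$ is said to be almost uniformly distributed with respect to $\nu$ if there exists a strictly increasing sequence $(N_{j})_{j\ge 1}$ of positive integers such that for every arc $I\subset\mathbb{T}$ whose endpoints are not atoms of $\nu$ one has $$\lim_{j\to+\infty}\frac{1}{N_{j}}\,\#\{k\le N_{j} : e^{2i\pi n_{k}\theta}\in I\}=\nu(I).$$ The exceptional set $W((n_{k})_{k\ge 0},\nu)$ is the set of all $\theta\in\mathbb{R}$ such that $(n_{k}\theta)_{k\ge 0}$ is not almost uniformly distributed with respect to $\nu$. *)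

theory Defs
  imports "HOL-Analysis.Analysis"
begin

abbreviation circle_borel :: "complex measure" where
  "circle_borel \<equiv> restrict_space borel (sphere 0 1)"

text \<open>A (finite) complex measure is a set function; only its values on \<^term>\<open>sets M\<close> are
  constrained. Since the series condition covers all rearrangements, convergence is absolute.\<close>

definition complex_measure :: "'a measure \<Rightarrow> ('a set \<Rightarrow> complex) \<Rightarrow> bool" where
  "complex_measure M \<nu> \<longleftrightarrow>
     \<nu> {} = 0 \<and>
     (\<forall>A :: nat \<Rightarrow> 'a set. range A \<subseteq> sets M \<longrightarrow> disjoint_family A \<longrightarrow>
        (\<lambda>i. \<nu> (A i)) sums \<nu> (\<Union>i. A i))"

text \<open>The positive part of a finite signed measure \<open>\<sigma>\<close> in its Jordan decomposition,
  \<open>A \<mapsto> sup {\<sigma> B | B \<subseteq> A}\<close>. The supremum is nonnegative because \<open>B = {}\<close> is allowed,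
  so it is harmless that \<^const>\<open>ennreal\<close> truncates negative values to \<open>0\<close>.
  The negative part is the positive part of \<open>- \<sigma>\<close>.\<close>

definition positive_part :: "'a measure \<Rightarrow> ('a set \<Rightarrow> real) \<Rightarrow> 'a measure" where
  "positive_part M \<sigma> =
     measure_of (space M) (sets M) (\<lambda>A. SUP B\<in>{B \<in> sets M. B \<subseteq> A}. ennreal (\<sigma> B))"

definition signed_integral :: "'a measure \<Rightarrow> ('a set \<Rightarrow> real) \<Rightarrow> ('a \<Rightarrow> complex) \<Rightarrow> complex" where
  "signed_integral M \<sigma> f =
     integral\<^sup>L (positive_part M \<sigma>) f - integral\<^sup>L (positive_part M (\<lambda>A. - \<sigma> A)) f"

definition complex_integral :: "'a measure \<Rightarrow> ('a set \<Rightarrow> complex) \<Rightarrow> ('a \<Rightarrow> complex) \<Rightarrow> complex" where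
  "complex_integral M \<nu> f =
     signed_integral M (\<lambda>A. Re (\<nu> A)) f + \<i> * signed_integral M (\<lambda>A. Im (\<nu> A)) f"

definition fourier_coeff :: "(complex set \<Rightarrow> complex) \<Rightarrow> int \<Rightarrow> complex" where
  "fourier_coeff \<nu> n = complex_integral circle_borel \<nu> (\<lambda>z. z powi n)"

definition circle_exp :: "real \<Rightarrow> complex" where
  "circle_exp t = exp (2 * of_real pi * \<i> * of_real t)"

text \<open>\<open>I\<close> is an arc from \<open>circle_exp a\<close> to \<open>circle_exp b\<close>; each endpoint may or may not belong
  to \<open>I\<close>. For \<open>b = a + 1\<close> this gives the full circle and the circle minus a point, with the single
  endpoint \<open>circle_exp a\<close>.\<close>

definition circle_arc :: "real \<Rightarrow> real \<Rightarrow> complex set \<Rightarrow> bool" where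
  "circle_arc a b I \<longleftrightarrow>
     a < b \<and> b \<le> a + 1 \<and> (\<exists>J. {a<..<b} \<subseteq> J \<and> J \<subseteq> {a..b} \<and> I = circle_exp ` J)"

definition atom :: "(complex set \<Rightarrow> complex) \<Rightarrow> complex \<Rightarrow> bool" where
  "atom \<nu> z \<longleftrightarrow> \<nu> {z} \<noteq> 0"

definition almost_uniformly_distributed ::
    "(nat \<Rightarrow> int) \<Rightarrow> (complex set \<Rightarrow> complex) \<Rightarrow> real \<Rightarrow> bool" where
  "almost_uniformly_distributed n \<nu> \<theta> \<longleftrightarrow>
     (\<exists>N :: nat \<Rightarrow> nat. strict_mono N \<and> (\<forall>j. N j > 0) \<and>
        (\<forall>a b I. circle_arc a b I \<longrightarrow>
           \<not> atom \<nu> (circle_exp a) \<longrightarrow> \<not> atom \<nu> (circle_exp b) \<longrightarrow>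
           (\<lambda>j. of_nat (card {k. k \<le> N j \<and> circle_exp (of_int (n k) * \<theta>) \<in> I}) / of_nat (N j))
             \<longlonglongrightarrow> \<nu> I))"

definition exceptional_set :: "(nat \<Rightarrow> int) \<Rightarrow> (complex set \<Rightarrow> complex) \<Rightarrow> real set" where
  "exceptional_set n \<nu> = {\<theta>. \<not> almost_uniformly_distributed n \<nu> \<theta>}"

definition furstenberg_set :: "nat set" where
  "furstenberg_set = {2 ^ k * 3 ^ k' | k k'. True}"

definition furstenberg_seq :: "nat \<Rightarrow> int" where
  "furstenberg_seq k = int (enumerate furstenberg_set k)"

end

theory Submission
  imports Defs
begin

text \<open>Suppose the exceptional set were countable. We exhibit two parameters outside of it for which
  the frequency of visits to one and the same small arc around \<open>1\<close> is eventually at least \<open>3/10\<close>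
  and at most \<open>29/100\<close>, respectively; both frequencies would have limit points equal to the
  \<open>\<nu>\<close>-measure of the arc.

  Almost every \<open>\<theta>\<close> is of the second kind, by an \<open>L\<^sup>2\<close> estimate. For the first kind, take
  \<open>\<theta> = 2\<^sup>-\<^sup>a\<close>: in logarithmic coordinates, \<open>2\<^sup>i 3\<^sup>j \<theta>\<close> is close to \<open>0\<close> modulo \<open>1\<close> in the
  triangle \<open>2\<^sup>i 3\<^sup>j \<le> \<epsilon> 2\<^sup>a\<close> and in the half plane \<open>i \<ge> a\<close>, and these regions asymptotically
  fill at least one half (we use one third) of every triangle \<open>2\<^sup>i 3\<^sup>j \<le> Y\<close>. For a dyadic rational
  \<open>\<theta>\<close> the visits to \<open>0\<close> have density one, so adding \<open>2\<^sup>-\<^sup>a\<close> with \<open>a\<close> large preserves the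
  frequency bound for all \<open>N\<close>. Hence the dyadic parameters of the first kind have no isolated
  point, and their closure is a perfect set.\<close>

subsection \<open>Pairs with bounded smooth product\<close>

definition smooth_pairs :: "nat \<Rightarrow> (nat \<times> nat) set" where
  "smooth_pairs Y = {(i, j). 2 ^ i * 3 ^ j \<le> Y}"

lemma finite_smooth_pairs: "finite (smooth_pairs Y)"
proof (rule finite_subset)
  show "smooth_pairs Y \<subseteq> {..Y} \<times> {..Y}"
  proof clarify
    fix i j assume "(i, j) \<in> smooth_pairs Y"
    then have le: "2 ^ i * 3 ^ j \<le> Y" by (simp add: smooth_pairs_def)
    have "i < 2 ^ i" "j < 3 ^ j" by (rule power_gt_expt, simp)+
    moreover have "(2::nat) ^ i * 1 \<le> 2 ^ i * 3 ^ j" "1 * (3::nat) ^ j \<le> 2 ^ i * 3 ^ j"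
      by (auto intro!: mult_le_mono)
    ultimately have "i \<le> Y" "j \<le> Y" using le by linarith+
    then show "i \<in> {..Y} \<and> j \<in> {..Y}" by simp
  qed
qed auto

text \<open>The exponents are recovered from the product as its multiplicities at the primes 2 and
  3.\<close>

lemma inj_smooth: "inj (\<lambda>(i, j). 2 ^ i * 3 ^ j :: nat)"
proof (rule injI, clarify)
  fix i j k l :: nat assume eq: "(2::nat) ^ i * 3 ^ j = 2 ^ k * 3 ^ l"
  have *: "multiplicity (2::nat) (2 ^ a * 3 ^ b) = a" "multiplicity (3::nat) (2 ^ a * 3 ^ b) = b" for a b
    by (auto simp: prime_elem_multiplicity_mult_distrib multiplicity_distinct_prime_power)
  show "i = k \<and> j = l" using eq *[of i j] *[of k l] by simp
qed

lemma card_triangle: "card {(i, j). i + j < (n::nat)} * 2 = n * (n + 1)"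
proof -
  have "{(i, j). i + j < n} = (SIGMA i:{..<n}. {..<n - i})" by auto
  then have "card {(i, j). i + j < n} = (\<Sum>i<n. n - i)" by simp
  also have "\<dots> = (\<Sum>i<n. Suc i)"
    by (rule sum.reindex_bij_witness[of _ "\<lambda>i. n - Suc i" "\<lambda>i. n - Suc i"]) auto
  also have "\<dots> * 2 = n * (n + 1)" by (induction n) auto
  finally show ?thesis .
qed

lemma card_half_triangle: "card {(i, j). i + 2 * j \<le> 2 * (n::nat)} = (n + 1)\<^sup>2"
proof -
  have "{(i, j). i + 2 * j \<le> 2 * n} = prod.swap ` (SIGMA j:{..n}. {..2 * (n - j)})" by force
  then have "card {(i, j). i + 2 * j \<le> 2 * n} = (\<Sum>j\<le>n. Suc (2 * (n - j)))"
    by (simp add: card_image)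
  also have "\<dots> = (\<Sum>j\<le>n. Suc (2 * j))"
    by (rule sum.reindex_bij_witness[of _ "\<lambda>i. n - i" "\<lambda>i. n - i"]) auto
  also have "\<dots> = (n + 1)\<^sup>2" by (induction n) (auto simp: power2_eq_square)
  finally show ?thesis .
qed

lemma smooth_pairs_mono: "Y \<le> Z \<Longrightarrow> smooth_pairs Y \<subseteq> smooth_pairs Z"
  by (auto simp: smooth_pairs_def)

text \<open>Bounding 3 by 4 = 2^2 replaces the logarithmic slope by an integer one, so that a
  lattice triangle of known size fits inside.\<close>

lemma half_triangle_subset: "{(i, j). i + 2 * j \<le> n} \<subseteq> smooth_pairs (2 ^ n)"
proof clarify
  fix i j assume *: "i + 2 * j \<le> n"
  have "(2::nat) ^ i * 3 ^ j \<le> 2 ^ i * 4 ^ j" by (simp add: power_mono)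
  also have "\<dots> = 2 ^ (i + 2 * j)" by (simp add: power_add power_mult)
  also have "\<dots> \<le> 2 ^ n" using * by (intro power_increasing) auto
  finally show "(i, j) \<in> smooth_pairs (2 ^ n)" by (simp add: smooth_pairs_def)
qed

lemma triangle_subset: "{(i, j). i + j \<le> n} \<subseteq> smooth_pairs (3 ^ n)"
proof clarify
  fix i j assume *: "i + j \<le> n"
  have "(2::nat) ^ i * 3 ^ j \<le> 3 ^ i * 3 ^ j" by (simp add: power_mono)
  also have "\<dots> = 3 ^ (i + j)" by (simp add: power_add)
  also have "\<dots> \<le> 3 ^ n" using * by (intro power_increasing) auto
  finally show "(i, j) \<in> smooth_pairs (3 ^ n)" by (simp add: smooth_pairs_def)
qed

text \<open>In a fixed row \<open>i\<close> the values grow by factors of 3 and stay in a window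
  whose ends have ratio below \<open>3 ^ n\<close>, so the exponents lie among \<open>n\<close>
  consecutive ones, starting with the least.\<close>

lemma card_powers3_between:
  assumes "Y < 3 ^ n * (c::nat)"
  shows "card {j. c < 2 ^ i * 3 ^ j \<and> 2 ^ i * 3 ^ j \<le> Y} \<le> n"
    and "finite {j. c < 2 ^ i * 3 ^ j \<and> 2 ^ i * 3 ^ j \<le> Y}"
proof -
  let ?S = "{j. c < 2 ^ i * 3 ^ j \<and> 2 ^ i * 3 ^ j \<le> Y}"
  define m where "m = (LEAST j. j \<in> ?S)"
  have sub: "?S \<subseteq> {m..<m + n}"
  proof
    fix j assume j: "j \<in> ?S"
    then have m: "m \<in> ?S" "m \<le> j" unfolding m_def by (rule LeastI, rule Least_le)
    have "3 ^ (j - m) * c \<le> 3 ^ (j - m) * (2 ^ i * 3 ^ m)" using m by auto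
    also have "\<dots> = 2 ^ i * 3 ^ j" using m by (simp flip: power_add)
    also have "\<dots> < 3 ^ n * c" using j assms by auto
    finally have "(3::nat) ^ (j - m) < 3 ^ n" by simp
    then show "j \<in> {m..<m + n}" using m by auto
  qed
  from card_mono[OF _ sub] show "card ?S \<le> n" by simp
  from finite_subset[OF sub] show "finite ?S" by simp
qed

text \<open>Prepares the parameter \<open>1 / 2 ^ (2 * d + 6)\<close>: for the pairs counted on the
  right, the product times this parameter is an integer or at most 1/64. The other pairs lie in a
  strip of \<open>2 * d + 6\<close> rows, and they are at most twice as many as the pairs in two
  triangles inside the good set.\<close>

lemma card_smooth_pairs_near_zero:
  assumes "d \<ge> 12"
  shows "card (smooth_pairs Y) \<le>
    3 * card {(i, j) \<in> smooth_pairs Y. 2 * d + 6 \<le> i \<or> 2 ^ i * 3 ^ j \<le> (2::nat) ^ (2 * d)}"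
    (is "_ \<le> 3 * card ?G")
proof -
  define B where "B = {(i, j) \<in> smooth_pairs Y. i < 2 * d + 6 \<and> (2::nat) ^ (2 * d) < 2 ^ i * 3 ^ j}"
  have fin: "finite ?G" "finite B"
    by (auto intro!: finite_subset[OF _ finite_smooth_pairs[of Y]] simp: B_def)
  have un: "smooth_pairs Y = ?G \<union> B" by (auto simp: B_def)
  have "card B \<le> 2 * card ?G"
  proof (cases "Y < 2 ^ (2 * d)")
    case True
    then have "B = {}" by (auto simp: B_def smooth_pairs_def)
    then show ?thesis by simp
  next
    case False
    define a where "a = 2 * d + 6"
    \<comment> \<open>\<open>M\<close> is the number of admissible exponents of 3 in the row
      \<open>i = a\<close>. It controls both the row lengths in the strip and the size of the
      triangle beyond it.\<close>
    define M where "M = (LEAST M. Y < 2 ^ a * 3 ^ M)"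
    have "Y < 3 ^ Y" by (rule power_gt_expt) auto
    also have "3 ^ Y \<le> (2::nat) ^ a * 3 ^ Y" by simp
    finally have "\<exists>M. Y < 2 ^ a * 3 ^ M" by blast
    then have M: "Y < 2 ^ a * 3 ^ M" unfolding M_def by (rule LeastI_ex)
    have Ml: "2 ^ a * 3 ^ m \<le> Y" if "m < M" for m
      using not_less_Least[OF that[unfolded M_def]] by simp
    \<comment> \<open>The six extra factors 2 in \<open>2 ^ a\<close> cost at most four factors 3,
      since 64 \<le> 81. Hence each row of the strip has at most \<open>M + 4\<close> pairs.\<close>
    have "Y < 3 ^ (M + 4) * 2 ^ (2 * d)"
    proof -
      have "(2::nat) ^ a * 3 ^ M = 64 * (3 ^ M * 2 ^ (2 * d))" by (simp add: a_def power_add)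
      also have "\<dots> \<le> 81 * (3 ^ M * 2 ^ (2 * d))" by simp
      also have "\<dots> = 3 ^ (M + 4) * 2 ^ (2 * d)" by (simp add: power_add)
      finally show ?thesis using M by simp
    qed
    note row = card_powers3_between[OF this]
    have "B = (SIGMA i:{..<a}. {j. (2::nat) ^ (2 * d) < 2 ^ i * 3 ^ j \<and> 2 ^ i * 3 ^ j \<le> Y})"
      by (auto simp: B_def smooth_pairs_def a_def)
    then have "card B = (\<Sum>i<a. card {j. (2::nat) ^ (2 * d) < 2 ^ i * 3 ^ j \<and> 2 ^ i * 3 ^ j \<le> Y})"
      using row(2) by (simp only:) (subst card_SigmaI, auto)
    also have "\<dots> \<le> (\<Sum>i<a. M + 4)" by (intro sum_mono row)
    finally have B: "card B \<le> a * (M + 4)" by simp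
    \<comment> \<open>\<open>?G1\<close> sits among the products up to \<open>2 ^ (2 * d)\<close>,
      and \<open>?G2\<close> in the half plane \<open>i \<ge> a\<close>.\<close>
    let ?G1 = "{(i, j). i + 2 * j \<le> 2 * d}" and ?G2 = "(\<lambda>(i, j). (a + i, j)) ` {(i, j). i + j < M}"
    have G1: "?G1 \<subseteq> ?G"
      using half_triangle_subset[of "2 * d"] False by (auto simp: smooth_pairs_def)
    have G2: "?G2 \<subseteq> ?G"
    proof -
      have "2 ^ (a + i) * 3 ^ j \<le> Y" if "i + j < M" for i j
      proof -
        have "2 ^ i * 3 ^ j \<le> (3::nat) ^ (i + j)"
          using triangle_subset[of "i + j"] by (auto simp: smooth_pairs_def)
        then have "2 ^ (a + i) * 3 ^ j \<le> (2::nat) ^ a * 3 ^ (i + j)" by (simp add: power_add)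
        also have "\<dots> \<le> Y" using Ml that by blast
        finally show ?thesis .
      qed
      then show ?thesis by (auto simp: smooth_pairs_def a_def)
    qed
    have "?G1 \<inter> ?G2 = {}" by (auto simp: a_def)
    then have "card ?G1 + card ?G2 = card (?G1 \<union> ?G2)"
      using finite_subset[OF G1] finite_subset[OF G2] fin by (simp add: card_Un_disjoint)
    also have "\<dots> \<le> card ?G" using G1 G2 fin by (intro card_mono) auto
    finally have G: "(d + 1)\<^sup>2 + card ?G2 \<le> card ?G" by (simp add: card_half_triangle)
    have "card ?G2 = card {(i, j). i + j < M}" by (intro card_image) (auto simp: inj_on_def)
    then have G': "card ?G2 * 2 = M * (M + 1)" by (simp add: card_triangle)
    have "int a * (int M + 4) \<le> 2 * (int d + 1)\<^sup>2 + int M * (int M + 1)"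
    proof -
      \<comment> \<open>In terms of \<open>t\<close>, the difference of the two sides is a product
        of consecutive integers, hence nonnegative, plus an expression in \<open>d\<close> alone
        that is nonnegative for \<open>d \<ge> 12\<close>.\<close>
      define t where "t = int M - int d - 1"
      have "0 \<le> (t - 1) * (t - 2)"
        by (cases "t \<le> 1") (auto simp: zero_le_mult_iff)
      moreover have "12 * int d \<le> int d * int d" using assms by (intro mult_right_mono) auto
      moreover have "12 \<le> int d" using assms by simp
      moreover have "2 * (int d + 1)\<^sup>2 + int M * (int M + 1) - int a * (int M + 4) =
          (t - 1) * (t - 2) + (int d * int d - 12 * int d) + (3 * int d - 28)"
        unfolding t_def a_def by (simp add: power2_eq_square algebra_simps)
      ultimately show ?thesis by linarith
    qed
    then have "int (a * (M + 4)) \<le> int (2 * (d + 1)\<^sup>2 + M * (M + 1))" unfolding of_nat_add of_nat_mult of_nat_power of_nat_numeral of_nat_1 .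
    then have "a * (M + 4) \<le> 2 * (d + 1)\<^sup>2 + M * (M + 1)" by linarith
    then show ?thesis using B G G' by linarith
  qed
  then show ?thesis using card_Un_le[of ?G B, folded un] by linarith
qed

section \<open>From the increasing enumeration to pairs of exponents\<close>

lemma furstenberg_set_eq: "furstenberg_set = range (\<lambda>(i, j). 2 ^ i * 3 ^ j)"
  by (auto simp: furstenberg_set_def)

lemma infinite_furstenberg_set: "infinite furstenberg_set"
  using inj_smooth by (simp add: furstenberg_set_eq finite_image_iff finite_prod) 

text \<open>The enumeration is strictly increasing, so indices up to \<open>N\<close> match the
  elements up to the one with index \<open>N\<close>, and each element has a unique pair of
  exponents. Indices start at 0, so a trivial \<open>P\<close> gives \<open>N + 1\<close>
  pairs.\<close>

lemma card_enumerate_smooth: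
  "card {k. k \<le> N \<and> P (enumerate furstenberg_set k)} =
   card {(i, j) \<in> smooth_pairs (enumerate furstenberg_set N). P (2 ^ i * 3 ^ j)}"
proof -
  let ?e = "enumerate furstenberg_set" and ?f = "\<lambda>(i, j). 2 ^ i * 3 ^ j :: nat"
  note inf = infinite_furstenberg_set
  let ?A = "{n \<in> furstenberg_set. n \<le> ?e N \<and> P n}"
  have "?e ` {k. k \<le> N \<and> P (?e k)} = ?A"
  proof (intro equalityI subsetI)
    fix n assume n: "n \<in> ?A"
    then obtain k where "n = ?e k" using enumerate_Ex[OF inf, of n] by auto
    then show "n \<in> ?e ` {k. k \<le> N \<and> P (?e k)}" using n inf by auto
  qed (auto simp: inf enumerate_in_set)
  moreover have "?f ` {(i, j) \<in> smooth_pairs (?e N). P (2 ^ i * 3 ^ j)} = ?A"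
    by (auto simp: furstenberg_set_eq smooth_pairs_def)
  moreover have "inj_on ?e {k. k \<le> N \<and> P (?e k)}"
    using inj_enumerate[OF inf] by (rule inj_on_subset) simp
  moreover have "inj_on ?f {(i, j) \<in> smooth_pairs (?e N). P (2 ^ i * 3 ^ j)}"
    using inj_smooth by (rule inj_on_subset) simp
  ultimately show ?thesis by (metis (no_types, lifting) card_image)
qed

subsection \<open>Parameters with many visits near zero\<close>

text \<open>If \<open>J\<close> is the largest exponent with \<open>3 ^ J \<le> Y\<close>, the strip
  has at most \<open>s * (J + 1)\<close> pairs, while a triangle of (J + 1)(J + 2)/2 pairs fits
  below \<open>Y\<close>. The factor 60 makes the ratio at most 1/30.\<close>

lemma card_smooth_pairs_strip:
  assumes "3 ^ (60 * s) \<le> Y"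
  shows "30 * card {(i, j) \<in> smooth_pairs Y. i < s} \<le> card (smooth_pairs Y)"
proof -
  have "1 \<le> Y" using assms by (meson le_trans one_le_numeral one_le_power)
  then obtain J where J: "3 ^ J \<le> Y" "Y < 3 ^ (J + 1)" using ex_power_ivl1[of 3 Y] by auto
  have "(3::nat) ^ (60 * s) < 3 ^ (J + 1)" using J assms by linarith
  then have sJ: "60 * s \<le> J" by (simp del: power_Suc add: Suc_eq_plus1[symmetric])
  have "{(i, j) \<in> smooth_pairs Y. i < s} \<subseteq> {..<s} \<times> {..J}"
  proof clarsimp
    fix i j assume "(i, j) \<in> smooth_pairs Y"
    then have "2 ^ i * 3 ^ j \<le> Y" by (simp add: smooth_pairs_def)
    moreover have "1 * (3::nat) ^ j \<le> 2 ^ i * 3 ^ j" by (intro mult_le_mono) auto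
    ultimately have "(3::nat) ^ j < 3 ^ (J + 1)" using J by linarith
    then show "j \<le> J" by (simp del: power_Suc add: Suc_eq_plus1[symmetric])
  qed
  from card_mono[OF _ this] have strip: "card {(i, j) \<in> smooth_pairs Y. i < s} \<le> s * (J + 1)"
    by (simp add: card_cartesian_product)
  have "{(i, j). i + j < J + 1} \<subseteq> smooth_pairs Y"
    using triangle_subset[of J] smooth_pairs_mono[OF J(1)] by (auto simp: less_Suc_eq_le)
  from card_mono[OF finite_smooth_pairs this]
  have "(J + 1) * (J + 2) \<le> 2 * card (smooth_pairs Y)"
    using card_triangle[of "J + 1"] by simp
  moreover have "60 * s * (J + 1) \<le> (J + 2) * (J + 1)" using sJ by (intro mult_right_mono) auto
  ultimately show ?thesis using strip by (simp add: algebra_simps)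
qed

lemma cos_2pi_int_add: "z \<in> \<int> \<Longrightarrow> cos (2 * pi * (z + x)) = cos (2 * pi * x)"
proof (elim Ints_cases)
  fix m assume "z = of_int m"
  then show ?thesis
    using cos_int_2pin[of m] sin_int_2pin[of m] by (simp add: cos_add distrib_left)
qed

text \<open>The bound 1/64 stems from the 6 in \<open>2 * d + 6\<close>. As pi < 4, the squared sine
  of \<open>pi * x\<close> is at most 1/256, and 1 - 2/256 exceeds 99/100.\<close>

lemma cos_2pi_near_zero:
  assumes "0 \<le> x" "x \<le> 1 / 64"
  shows "cos (2 * pi * x) > 99 / 100"
proof -
  have "pi * x \<le> 4 * (1 / 64)" using assms pi_less_4 by (intro mult_mono) auto
  then have "(pi * x)\<^sup>2 \<le> (1 / 16)\<^sup>2" using assms by (intro power_mono) auto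
  moreover have "(sin (pi * x))\<^sup>2 \<le> (pi * x)\<^sup>2"
    using abs_sin_x_le_abs_x[of "pi * x"] by (simp add: abs_le_square_iff)
  moreover have "cos (2 * pi * x) = 1 - 2 * (sin (pi * x))\<^sup>2"
    using cos_double_sin[of "pi * x"] by (simp add: mult.assoc)
  ultimately show ?thesis by (simp add: power2_eq_square)
qed

abbreviation rotation :: "nat \<Rightarrow> real \<Rightarrow> real" where
  "rotation k \<theta> \<equiv> 2 * pi * (of_int (furstenberg_seq k) * \<theta>)"

text \<open>The strict threshold is an open condition, so finitely many visits survive a small
  perturbation. The dyadic condition makes the cosine equal to 1 at all products with
  \<open>i \<ge> s\<close>, which serves all large \<open>N\<close> at once.\<close>

definition dyadic_recurrent :: "real set" where
  "dyadic_recurrent = {\<theta>. (\<exists>s. 2 ^ s * \<theta> \<in> \<int>) \<and>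
     (\<forall>N. 3 / 10 * real (N + 1) \<le> card {k. k \<le> N \<and> cos (rotation k \<theta>) > 99 / 100})}"

text \<open>For \<open>i \<ge> s\<close> the contribution of \<open>\<theta>\<close> is an integer
  and only the perturbation is seen, so the good pairs of the previous count are visits. The rows
  \<open>i < s\<close> are given up.\<close>

lemma card_near_zero_perturbed:
  assumes s: "2 ^ s * \<theta> \<in> \<int>" and d: "d \<ge> 12" and N: "3 ^ (60 * s) \<le> N"
  shows "3 / 10 * real (N + 1) \<le>
    card {k. k \<le> N \<and> cos (rotation k (\<theta> + 1 / 2 ^ (2 * d + 6))) > 99 / 100}"
proof -
  let ?Y = "enumerate furstenberg_set N" and ?t = "\<theta> + 1 / 2 ^ (2 * d + 6)"
  let ?C = "\<lambda>n::nat. cos (2 * pi * (real n * ?t)) > 99 / 100"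
  let ?G = "{(i, j) \<in> smooth_pairs ?Y. 2 * d + 6 \<le> i \<or> 2 ^ i * 3 ^ j \<le> (2::nat) ^ (2 * d)}"
  let ?S = "{(i, j) \<in> smooth_pairs ?Y. i < s}"
  let ?R = "{(i, j) \<in> smooth_pairs ?Y. ?C (2 ^ i * 3 ^ j)}"
  have fin: "finite ?S" "finite ?R"
    by (auto intro!: finite_subset[OF _ finite_smooth_pairs[of ?Y]])
  have "?G \<subseteq> ?R \<union> ?S"
  proof
    fix p assume "p \<in> ?G"
    then obtain i j where p: "p = (i, j)" and T: "(i, j) \<in> smooth_pairs ?Y"
      and G: "2 * d + 6 \<le> i \<or> 2 ^ i * 3 ^ j \<le> (2::nat) ^ (2 * d)" by auto
    let ?n = "2 ^ i * 3 ^ j :: nat"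
    have "?C ?n" if "s \<le> i"
    proof -
      from that have "real ?n * \<theta> = 2 ^ (i - s) * 3 ^ j * (2 ^ s * \<theta>)" by (simp flip: power_add)
      also have "\<dots> \<in> \<int>" using s by (intro Ints_mult[OF _ s]) auto
      finally have eq: "cos (2 * pi * (real ?n * ?t)) = cos (2 * pi * (real ?n / 2 ^ (2 * d + 6)))"
        using cos_2pi_int_add[of "real ?n * \<theta>" "real ?n / 2 ^ (2 * d + 6)"] by (simp add: distrib_left)
      show "?C ?n"
      proof (cases "2 * d + 6 \<le> i")
        case True
        then have "(2::real) ^ i = 2 ^ (i - (2 * d + 6)) * 2 ^ (2 * d + 6)" by (metis le_add_diff_inverse2 power_add)
        then have "real ?n / 2 ^ (2 * d + 6) = 2 ^ (i - (2 * d + 6)) * 3 ^ j" by simp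
        also have "\<dots> \<in> \<int>" by (intro Ints_mult) auto
        finally show ?thesis unfolding eq using cos_2pi_int_add[of "real ?n / 2 ^ (2 * d + 6)" 0] by simp
      next
        case False
        then have "real ?n \<le> real (2 ^ (2 * d))" using G by (intro of_nat_mono) auto
        then show ?thesis unfolding eq
          by (intro cos_2pi_near_zero) (auto simp: power_add field_simps)
      qed
    qed
    then show "p \<in> ?R \<union> ?S" using T p by (cases "i < s") auto
  qed
  then have "card ?G \<le> card (?R \<union> ?S)" using fin by (intro card_mono) auto
  then have G_le: "card ?G \<le> card ?R + card ?S" using card_Un_le[of ?R ?S] by linarith
  have "3 ^ (60 * s) \<le> ?Y" using N le_enumerate[OF infinite_furstenberg_set, of N] by linarith
  then have S_le: "30 * card ?S \<le> card (smooth_pairs ?Y)" by (rule card_smooth_pairs_strip)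
  have N_eq: "card (smooth_pairs ?Y) = N + 1"
    using card_enumerate_smooth[of N "\<lambda>_. True"] by (simp flip: atMost_def)
  have R_eq: "card ?R = card {k. k \<le> N \<and> cos (rotation k ?t) > 99 / 100}"
    using card_enumerate_smooth[of N ?C] by (simp add: furstenberg_seq_def)
  \<comment> \<open>The good pairs are at least a third of all pairs and the strip is at most a
    thirtieth: 1/3 - 1/30 = 3/10.\<close>
  have "g \<le> r + s \<Longrightarrow> a \<le> 3 * g \<Longrightarrow> 30 * s \<le> a \<Longrightarrow> 3 / 10 * real a \<le> real r" for a g r s :: nat
    by linarith
  from this[OF G_le card_smooth_pairs_near_zero[OF d] S_le] show ?thesis
    unfolding N_eq R_eq .
qed

text \<open>From \<open>3 ^ (60 * s)\<close> on, the count holds for every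
  \<open>d \<ge> 12\<close>. Below that, only finitely many visits must be preserved, and continuity
  does so for large \<open>d\<close>.\<close>

lemma dyadic_recurrent_perturb:
  assumes "\<theta> \<in> dyadic_recurrent"
  shows "\<forall>\<^sub>F d in sequentially. \<theta> + 1 / 2 ^ (2 * d + 6) \<in> dyadic_recurrent"
proof -
  from assms obtain s where s: "2 ^ s * \<theta> \<in> \<int>"
    and dens: "\<And>N. 3 / 10 * real (N + 1) \<le> card {k. k \<le> N \<and> cos (rotation k \<theta>) > 99 / 100}"
    by (auto simp: dyadic_recurrent_def)
  have lim: "(\<lambda>d. \<theta> + 1 / 2 ^ (2 * d + 6)) \<longlonglongrightarrow> \<theta>" by real_asymp
  have "\<forall>\<^sub>F d in sequentially. cos (rotation k (\<theta> + 1 / 2 ^ (2 * d + 6))) > 99 / 100"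
    if "cos (rotation k \<theta>) > 99 / 100" for k
  proof (rule order_tendstoD(1)[OF _ that])
    show "(\<lambda>d. cos (rotation k (\<theta> + 1 / 2 ^ (2 * d + 6)))) \<longlonglongrightarrow> cos (rotation k \<theta>)"
      by (intro tendsto_intros lim)
  qed
  then have "\<forall>\<^sub>F d in sequentially. \<forall>k\<in>{..3 ^ (60 * s)}. cos (rotation k \<theta>) > 99 / 100 \<longrightarrow>
      cos (rotation k (\<theta> + 1 / 2 ^ (2 * d + 6))) > 99 / 100"
    by (intro eventually_ball_finite) (auto simp: eventually_mono)
  then show ?thesis using eventually_ge_at_top[of 12]
  proof eventually_elim
    case (elim d)
    let ?t = "\<theta> + 1 / 2 ^ (2 * d + 6)"
    have "2 ^ (s + 2 * d + 6) * ?t = 2 ^ (2 * d + 6) * (2 ^ s * \<theta>) + 2 ^ s"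
      by (simp add: power_add field_simps)
    also have "\<dots> \<in> \<int>" by (intro Ints_add Ints_mult[OF _ s]) auto
    finally have "\<exists>s. 2 ^ s * ?t \<in> \<int>" by blast
    moreover have "3 / 10 * real (N + 1) \<le> card {k. k \<le> N \<and> cos (rotation k ?t) > 99 / 100}" for N
    proof (cases "3 ^ (60 * s) \<le> N")
      case True
      then show ?thesis using card_near_zero_perturbed[OF s \<open>12 \<le> d\<close>] by blast
    next
      case False
      have "card {k. k \<le> N \<and> cos (rotation k \<theta>) > 99 / 100} \<le> card {k. k \<le> N \<and> cos (rotation k ?t) > 99 / 100}"
        using elim(1) False by (intro card_mono) auto
      then show ?thesis using dens[of N] by linarith
    qed
    ultimately show ?case unfolding dyadic_recurrent_def by blast
  qed
qed

text \<open>The weak inequality lets the set contain the closure of \<open>dyadic_recurrent\<close>.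
  That closure is nonempty and has no isolated point, so it is a perfect set in a complete space and
  at least as large as the reals.\<close>

lemma uncountable_recurrent:
  "uncountable {\<theta>. \<forall>N. 3 / 10 * real (N + 1) \<le> card {k. k \<le> N \<and> cos (rotation k \<theta>) \<ge> 99 / 100}}"
    (is "uncountable ?A")
proof -
  let ?D = dyadic_recurrent
  have islimpt: "\<theta> islimpt ?D" if "\<theta> \<in> ?D" for \<theta>
  proof -
    from dyadic_recurrent_perturb[OF that] obtain d0
      where d0: "\<And>d. d \<ge> d0 \<Longrightarrow> \<theta> + 1 / 2 ^ (2 * d + 6) \<in> ?D" by (auto simp: eventually_sequentially)
    have "\<theta> + 1 / 2 ^ (2 * (d + d0) + 6) \<in> ?D - {\<theta>}" for d
      using d0[of "d + d0"] by simp
    moreover have "(\<lambda>d. \<theta> + 1 / 2 ^ (2 * (d + d0) + 6)) \<longlonglongrightarrow> \<theta>" by real_asymp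
    ultimately show ?thesis unfolding islimpt_sequential
      by (intro exI[of _ "\<lambda>d. \<theta> + 1 / 2 ^ (2 * (d + d0) + 6)"]) auto
  qed
  have "0 \<in> ?D"
  proof -
    have "3 / 10 * real (N + 1) \<le> real (card {k. k \<le> N})" for N by (simp flip: atMost_def)
    then show ?thesis by (auto simp: dyadic_recurrent_def)
  qed
  have "{x. x islimpt closure ?D} = closure ?D"
  proof (intro equalityI subsetI; clarify)
    fix x assume "x islimpt closure ?D"
    then show "x \<in> closure ?D" using closed_closure closed_limpt by blast
  next
    fix x assume "x \<in> closure ?D"
    then have "x islimpt ?D" using islimpt by (auto simp: closure_def)
    then show "x islimpt closure ?D" using closure_subset by (rule islimpt_subset)
  qed
  moreover have "euclidean derived_set_of S = {x. x islimpt S}" for S :: "real set"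
    by (auto simp: derived_set_of_def islimpt_def)
  ultimately have "euclidean derived_set_of closure ?D = closure ?D" by simp
  then have "(UNIV::real set) \<lesssim> closure ?D"
    using \<open>0 \<in> ?D\<close> closure_subset[of ?D]
    by (intro lepoll_perfect_set[of euclidean]) (auto simp: completely_metrizable_space_euclidean)
  then have "uncountable (closure ?D)"
    using countable_lepoll uncountable_UNIV_real by blast
  moreover have "closure ?D \<subseteq> ?A"
  proof clarify
    fix \<theta> N assume "\<theta> \<in> closure ?D"
    then obtain t where t: "\<And>m. t m \<in> ?D" "t \<longlonglongrightarrow> \<theta>" unfolding closure_sequential by blast
    \<comment> \<open>Missing the threshold at \<open>\<theta>\<close> is an open condition and
      persists at nearby \<open>t m\<close>. Hence, for large \<open>m\<close>, the visits of
      \<open>t m\<close> up to \<open>N\<close> are visits of \<open>\<theta>\<close>.\<close>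
    have "\<forall>\<^sub>F m in sequentially. cos (rotation k (t m)) < 99 / 100" if "cos (rotation k \<theta>) < 99 / 100" for k
      by (rule order_tendstoD(2)[OF _ that]) (intro tendsto_intros t)
    then have "\<forall>\<^sub>F m in sequentially. \<forall>k\<in>{..N}. cos (rotation k \<theta>) < 99 / 100 \<longrightarrow> cos (rotation k (t m)) < 99 / 100"
      by (intro eventually_ball_finite) (auto simp: eventually_mono)
    then obtain m where m: "\<forall>k\<in>{..N}. cos (rotation k \<theta>) < 99 / 100 \<longrightarrow> cos (rotation k (t m)) < 99 / 100"
      by (auto simp: eventually_sequentially)
    have "card {k. k \<le> N \<and> cos (rotation k (t m)) > 99 / 100} \<le> card {k. k \<le> N \<and> cos (rotation k \<theta>) \<ge> 99 / 100}"
      using m by (intro card_mono) (auto simp: not_less intro: leI)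
    moreover have "3 / 10 * real (N + 1) \<le> card {k. k \<le> N \<and> cos (rotation k (t m)) > 99 / 100}"
      using t(1)[of m] by (simp add: dyadic_recurrent_def)
    ultimately show "3 / 10 * real (N + 1) \<le> card {k. k \<le> N \<and> cos (rotation k \<theta>) \<ge> 99 / 100}"
      by linarith
  qed
  ultimately show ?thesis using countable_subset by blast
qed

subsection \<open>Almost every parameter has few visits near zero\<close>

lemma integral_cos_2pi_int:
  assumes "m \<noteq> (0::int)"
  shows "integral {0..1} (\<lambda>x. cos (2 * pi * m * x)) = 0"
proof -
  have "((\<lambda>x. cos (2 * pi * m * x)) has_integral
      sin (2 * pi * m * 1) / (2 * pi * m) - sin (2 * pi * m * 0) / (2 * pi * m)) {0..1}"
    using assms by (intro fundamental_theorem_of_calculus)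
      (auto intro!: derivative_eq_intros simp flip: has_real_derivative_iff_has_vector_derivative)
  moreover have "sin (2 * pi * m * 1) = 0" using sin_int_2pin[of m] by simp
  ultimately show ?thesis by (simp add: integral_unique)
qed

text \<open>By the product-to-sum formula. Positivity excludes \<open>p + q = 0\<close>, so only the
  difference frequency can vanish.\<close>

lemma integral_cos_mult_cos:
  fixes p q :: int
  assumes "p > 0" "q > 0"
  shows "integral {0..1} (\<lambda>x. cos (2 * pi * p * x) * cos (2 * pi * q * x)) = (if p = q then 1 / 2 else 0)"
proof -
  have eq: "cos (2 * pi * p * x) * cos (2 * pi * q * x) =
      cos (2 * pi * (p - q) * x) / 2 + cos (2 * pi * (p + q) * x) / 2" for x :: real
  proof -
    have "2 * pi * (p - q) * x = 2 * pi * p * x - 2 * pi * q * x"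
      "2 * pi * (p + q) * x = 2 * pi * p * x + 2 * pi * q * x"
      by (simp_all add: algebra_simps)
    then show ?thesis by (simp only: cos_times_cos add_divide_distrib)
  qed
  have int: "(\<lambda>x. cos (2 * pi * real_of_int m * x) / 2) integrable_on {0..1}" for m
    by (intro integrable_continuous_interval continuous_intros) auto
  have "integral {0..1} (\<lambda>x. cos (2 * pi * p * x) * cos (2 * pi * q * x)) =
      integral {0..1} (\<lambda>x. cos (2 * pi * (p - q) * x) / 2) + integral {0..1} (\<lambda>x. cos (2 * pi * (p + q) * x) / 2)"
    unfolding eq using int[of "p - q"] int[of "p + q"] by (subst Henstock_Kurzweil_Integration.integral_add) auto
  also have "\<dots> = (if p = q then 1 / 2 else 0)"
    using integral_cos_2pi_int[of "p - q"] integral_cos_2pi_int[of "p + q"] assms by simp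
  finally show ?thesis .
qed

lemma integral_sum_cos_squared:
  fixes w :: "nat \<Rightarrow> int"
  assumes "inj w" "\<And>k. w k > 0"
  shows "integral {0..1} (\<lambda>x. (\<Sum>k<n. cos (2 * pi * w k * x))\<^sup>2) = n / 2"
proof -
  have "(\<Sum>k<n. cos (2 * pi * w k * x))\<^sup>2 =
      (\<Sum>k<n. \<Sum>l<n. cos (2 * pi * w k * x) * cos (2 * pi * w l * x))" for x :: real
    by (simp add: power2_eq_square sum_product)
  moreover have "(\<lambda>x. cos (2 * pi * w k * x) * cos (2 * pi * w l * x)) integrable_on {0..1}" for k l
    by (intro integrable_continuous_interval continuous_intros)
  ultimately have "integral {0..1} (\<lambda>x. (\<Sum>k<n. cos (2 * pi * w k * x))\<^sup>2) =
      (\<Sum>k<n. \<Sum>l<n. integral {0..1} (\<lambda>x. cos (2 * pi * w k * x) * cos (2 * pi * w l * x)))"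
    by (simp add: Henstock_Kurzweil_Integration.integral_sum Henstock_Kurzweil_Integration.integrable_sum)
  also have "\<dots> = (\<Sum>k<n. \<Sum>l<n. if k = l then 1 / 2 else 0)"
    using assms by (intro sum.cong refl) (simp add: integral_cos_mult_cos inj_eq)
  also have "\<dots> = n / 2" by simp
  finally show ?thesis .
qed

text \<open>Along the squares the \<open>L\<^sup>2\<close>-norms of the averages are square-summable, so the averages
  tend to \<open>0\<close> almost everywhere.\<close>

lemma AE_averages_cos_tendsto_0:
  fixes w :: "nat \<Rightarrow> int"
  assumes w: "inj w" "\<And>k. w k > 0"
  shows "AE x in lebesgue_on {0..1}. (\<lambda>m. (\<Sum>k<m\<^sup>2. cos (2 * pi * w k * x)) / m\<^sup>2) \<longlonglongrightarrow> 0"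
proof -
  let ?M = "lebesgue_on {0..1::real}"
  define u where "u m x = ((\<Sum>k<m\<^sup>2. cos (2 * pi * w k * x)) / real (m\<^sup>2))\<^sup>2" for m :: nat and x :: real
  have cont: "continuous_on {0..1} (u m)" for m
    unfolding u_def divide_inverse by (intro continuous_intros)
  then have int: "integrable ?M (u m)" for m by (rule continuous_imp_integrable_real)
  have "integral\<^sup>L ?M (u m) = 1 / (2 * (real m)\<^sup>2)" for m
  proof -
    have "integral\<^sup>L ?M (u m) = integral {0..1} (u m)"
      using int by (intro lebesgue_integral_eq_integral) auto
    also have "\<dots> = integral {0..1} (\<lambda>x. (\<Sum>k<m\<^sup>2. cos (2 * pi * w k * x))\<^sup>2) / (real (m\<^sup>2))\<^sup>2"
      by (simp add: u_def[abs_def] power_divide)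
    also have "\<dots> = 1 / (2 * (real m)\<^sup>2)"
      \<comment> \<open>At \<open>m = 0\<close> both sides are 0, as division by zero yields
        0.\<close>
      unfolding integral_sum_cos_squared[OF w] by (cases "m = 0") (simp_all add: power2_eq_square)
    finally show ?thesis .
  qed
  then have nn: "(\<integral>\<^sup>+x. ennreal (u m x) \<partial>?M) = ennreal (1 / (2 * (real m)\<^sup>2))" for m
    using nn_integral_eq_integral[OF int[of m]] by (simp add: u_def)
  have "(\<integral>\<^sup>+x. (\<Sum>m. ennreal (u m x)) \<partial>?M) = (\<Sum>m. ennreal (1 / (2 * (real m)\<^sup>2)))"
    using int by (subst nn_integral_suminf) (auto simp: nn)
  also have "\<dots> \<noteq> \<infinity>"
  proof -
    have "summable (\<lambda>m. 1 / 2 * (1 / (real m)\<^sup>2))"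
      using inverse_power_summable[of 2, where 'a = real] by (intro summable_mult) (simp add: divide_inverse)
    then have "summable (\<lambda>m. 1 / (2 * (real m)\<^sup>2))" by simp
    then show ?thesis by (simp add: suminf_ennreal2)
  qed
  finally have "AE x in ?M. (\<Sum>m. ennreal (u m x)) \<noteq> \<infinity>"
    using int by (intro nn_integral_PInf_AE) auto
  then show ?thesis
  proof eventually_elim
    case (elim x)
    then have "summable (\<lambda>m. u m x)" by (intro summable_suminf_not_top) (auto simp: u_def)
    then have "(\<lambda>m. sqrt (u m x)) \<longlonglongrightarrow> sqrt 0" by (intro tendsto_real_sqrt summable_LIMSEQ_zero)
    then have "(\<lambda>m. \<bar>(\<Sum>k<m\<^sup>2. cos (2 * pi * w k * x)) / m\<^sup>2\<bar>) \<longlonglongrightarrow> 0"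
      by (simp add: u_def)
    then show ?case by (rule tendsto_rabs_zero_cancel)
  qed
qed

text \<open>The kernel \<open>(1 + cos y) (1 + cos 3y)\<close> is nonnegative with mean \<open>1\<close>, and it exceeds \<open>18/5\<close>
  where \<open>cos y\<close> is close to \<open>1\<close>.\<close>

lemma indicator_le_kernel:
  "(18 / 5) * of_bool (cos y \<ge> 98 / 100) \<le>
    1 + cos y + cos (3 * y) + cos (2 * y) / 2 + cos (4 * y) / (2::real)"
proof -
  define c where "c = cos y"
  have c: "-1 \<le> c" "c \<le> 1" by (auto simp: c_def)
  have c3: "cos (3 * y) = 4 * c ^ 3 - 3 * c" by (simp add: c_def cos_treble_cos)
  have "cos y * cos (3 * y) = cos (2 * y) / 2 + cos (4 * y) / 2"
    using cos_times_cos[of "3 * y" y] by (simp add: add_divide_distrib mult.commute)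
  then have eq: "1 + cos y + cos (3 * y) + cos (2 * y) / 2 + cos (4 * y) / 2 = (1 + c) * (1 + cos (3 * y))"
    by (simp add: c_def algebra_simps)
  show ?thesis
  proof (cases "c \<ge> 98 / 100")
    case True
    \<comment> \<open>From c \<ge> 0.98 follows 4 c^2 - 3 \<ge> 0.84, so 1 + cos 3y \<ge> 1.82, and
      1.98 * 1.82 > 18/5.\<close>
    have "(98 / 100)\<^sup>2 \<le> c\<^sup>2" using True by (intro power_mono) auto
    then have "(98 / 100) * (84 / 100) \<le> c * (4 * c\<^sup>2 - 3)"
      using True by (intro mult_mono) (auto simp: power2_eq_square)
    moreover have "c * (4 * c\<^sup>2 - 3) = 4 * c ^ 3 - 3 * c"
      by (simp add: power2_eq_square power3_eq_cube right_diff_distrib)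
    ultimately have "182 / 100 \<le> 1 + cos (3 * y)" using c3 by linarith
    then have "(198 / 100) * (182 / 100) \<le> (1 + c) * (1 + cos (3 * y))"
      using True by (intro mult_mono) auto
    then show ?thesis using True unfolding eq by (simp add: c_def)
  next
    case False
    have "0 \<le> 1 + c" "0 \<le> 1 + cos (3 * y)" using c cos_ge_minus_one[of "3 * y"] by linarith+
    then have "0 \<le> (1 + c) * (1 + cos (3 * y))" by (rule mult_nonneg_nonneg)
    then show ?thesis using False unfolding eq by (simp add: c_def)
  qed
qed

text \<open>Almost everywhere the kernel averages tend to 1 along the squares, so the visit
  frequency there is eventually below 28/100, which exceeds 5/18. Interpolating between squares
  costs another 1/100.\<close>

lemma AE_few_visits_near_zero:
  "AE \<theta> in lebesgue_on {0..1}. \<forall>\<^sub>F N in sequentially.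
    card {k. k \<le> N \<and> cos (rotation k \<theta>) \<ge> 98 / 100} \<le> 29 / 100 * real N"
proof -
  have n: "inj furstenberg_seq" "\<And>k. furstenberg_seq k > 0"
  proof -
    show "inj furstenberg_seq"
      unfolding furstenberg_seq_def using inj_enumerate[OF infinite_furstenberg_set] by (simp add: inj_def)
    fix k show "furstenberg_seq k > 0"
      using enumerate_in_set[OF infinite_furstenberg_set, of k] by (auto simp: furstenberg_seq_def furstenberg_set_def)
  qed
  let ?g = "\<lambda>h m \<theta>. (\<Sum>k<m\<^sup>2. cos (of_int h * rotation k \<theta>)) / real (m\<^sup>2)"
  have AE: "AE \<theta> in lebesgue_on {0..1}. (\<lambda>m. ?g h m \<theta>) \<longlonglongrightarrow> 0" if "h > 0" for h :: int
    using AE_averages_cos_tendsto_0[of "\<lambda>k. h * furstenberg_seq k"] n that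
    by (simp add: inj_def algebra_simps)
  show ?thesis
    using AE[of 1, simplified] AE[of 2, simplified] AE[of 3, simplified] AE[of 4, simplified]
  proof eventually_elim
    case (elim \<theta>)
    let ?K = "\<lambda>m. 1 + ?g 1 m \<theta> + ?g 3 m \<theta> + ?g 2 m \<theta> / 2 + ?g 4 m \<theta> / 2"
    let ?V = "\<lambda>N. {k. k \<le> N \<and> cos (rotation k \<theta>) \<ge> 98 / 100}"
    have "(\<lambda>m. ?K m / (18 / 5)) \<longlonglongrightarrow> (1 + 0 + 0 + 0 / 2 + 0 / 2) / (18 / 5)"
      using elim by (intro tendsto_intros) auto
    then have "\<forall>\<^sub>F m in sequentially. ?K m / (18 / 5) < 28 / 100"
      by (rule order_tendstoD) simp
    \<comment> \<open>1008/1000 is 28/100 times 18/5.\<close>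
    then obtain m0 where m0: "\<And>m. m \<ge> m0 \<Longrightarrow> ?K m \<le> 1008 / 1000"
      by (force simp: eventually_sequentially)
    have square: "card {k. k < m\<^sup>2 \<and> cos (rotation k \<theta>) \<ge> 98 / 100} \<le> 28 / 100 * (real m)\<^sup>2"
      if "m \<ge> m0" "m > 0" for m
    proof -
      have "real (card {k. k < m\<^sup>2 \<and> cos (rotation k \<theta>) \<ge> 98 / 100}) =
          (\<Sum>k<m\<^sup>2. of_bool (cos (rotation k \<theta>) \<ge> 98 / 100))"
        by (simp add: Int_def)
      then have "(18 / 5) * real (card {k. k < m\<^sup>2 \<and> cos (rotation k \<theta>) \<ge> 98 / 100}) =
          (\<Sum>k<m\<^sup>2. (18 / 5) * of_bool (cos (rotation k \<theta>) \<ge> 98 / 100))"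
        by (simp only: sum_distrib_left)
      also have "\<dots> \<le> (\<Sum>k<m\<^sup>2. 1 + cos (rotation k \<theta>) + cos (3 * rotation k \<theta>)
          + cos (2 * rotation k \<theta>) / 2 + cos (4 * rotation k \<theta>) / 2)"
        by (intro sum_mono indicator_le_kernel)
      also have "\<dots> = ?K m * (real m)\<^sup>2"
        using \<open>m > 0\<close> by (simp add: sum.distrib distrib_right flip: sum_divide_distrib)
      also have "\<dots> \<le> 1008 / 1000 * (real m)\<^sup>2"
        using m0[OF \<open>m \<ge> m0\<close>] by (intro mult_right_mono) auto
      finally show ?thesis by simp
    qed
    \<comment> \<open>Each \<open>N\<close> is below some \<open>m\<^sup>2\<close> with
      \<open>m\<close> at most \<open>sqrt N + 2\<close>; the square of the latter is asymptotic to
      \<open>N\<close>.\<close>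
    have "\<forall>\<^sub>F N in sequentially. 28 / 100 * (sqrt (real N) + 2)\<^sup>2 \<le> 29 / 100 * real N"
      by real_asymp
    then show ?case using eventually_ge_at_top[of "m0\<^sup>2"]
    proof eventually_elim
      case (elim N)
      define m where "m = nat \<lfloor>sqrt (real N)\<rfloor> + 1"
      have m: "sqrt (real N) < m" "real m \<le> sqrt (real N) + 2" by (simp_all add: m_def) linarith+
      have "real N < (real m)\<^sup>2" using m(1) real_sqrt_less_iff[of "real N" "(real m)\<^sup>2"] by simp
      then have "N < m\<^sup>2" by (simp flip: of_nat_power)
      moreover have "real m0 \<le> sqrt (real N)" using elim by (simp add: real_le_rsqrt flip: of_nat_power)
      then have "m0 \<le> m" using m by linarith
      ultimately have "card (?V N) \<le> card {k. k < m\<^sup>2 \<and> cos (rotation k \<theta>) \<ge> 98 / 100}"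
        by (intro card_mono) auto
      also have "real \<dots> \<le> 28 / 100 * (real m)\<^sup>2" using \<open>m0 \<le> m\<close> by (intro square) (auto simp: m_def)
      also have "\<dots> \<le> 28 / 100 * (sqrt (real N) + 2)\<^sup>2" using m by (intro mult_left_mono power_mono) auto
      also have "\<dots> \<le> 29 / 100 * real N" by (rule elim)
      finally show ?case by simp
    qed
  qed
qed

subsection \<open>Arcs with nonatomic endpoints\<close>

text \<open>Infinitely many singletons of mass at least 1/(n + 1) would give, by countable
  additivity, a convergent series whose terms do not tend to 0.\<close>

lemma countable_singletons_complex_measure:
  assumes \<nu>: "complex_measure M \<nu>" and sets: "\<And>z. z \<in> S \<Longrightarrow> {z} \<in> sets M"
  shows "countable {z \<in> S. \<nu> {z} \<noteq> 0}"
proof -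
  have "finite {z \<in> S. norm (\<nu> {z}) \<ge> 1 / real (Suc n)}" (is "finite ?F") for n
  proof (rule ccontr)
    assume "infinite ?F"
    then obtain f :: "nat \<Rightarrow> 'a" where f: "inj f" "range f \<subseteq> ?F"
      using infinite_countable_subset by blast
    have "range (\<lambda>i. {f i}) \<subseteq> sets M" using f sets by auto
    moreover have "disjoint_family (\<lambda>i. {f i})"
      using f(1) by (auto simp: disjoint_family_on_def inj_def)
    ultimately have "summable (\<lambda>i. \<nu> {f i})"
      using \<nu> unfolding complex_measure_def by (blast intro: sums_summable)
    then have "(\<lambda>i. norm (\<nu> {f i})) \<longlonglongrightarrow> 0" by (intro tendsto_norm_zero summable_LIMSEQ_zero)
    moreover have "\<forall>i\<ge>0. norm (\<nu> {f i}) \<ge> 1 / real (Suc n)" using f(2) by auto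
    ultimately have "1 / real (Suc n) \<le> 0" by (blast intro: LIMSEQ_le_const)
    then show False by simp
  qed
  moreover have "{z \<in> S. \<nu> {z} \<noteq> 0} \<subseteq> (\<Union>n. {z \<in> S. norm (\<nu> {z}) \<ge> 1 / real (Suc n)})"
  proof clarsimp
    fix z assume "\<nu> {z} \<noteq> 0"
    then obtain n where "inverse (real (Suc n)) < norm (\<nu> {z})" using reals_Archimedean[of "norm (\<nu> {z})"] by auto
    then show "\<exists>n. 1 / (1 + real n) \<le> norm (\<nu> {z})" by (intro exI[of _ n]) (simp add: divide_inverse)
  qed
  ultimately show ?thesis
    by (elim countable_subset) (intro countable_UN countableI_type countable_finite)
qed

lemma circle_exp_eq_cis: "circle_exp t = cis (2 * pi * t)"
  by (simp add: circle_exp_def cis_conv_exp mult_ac)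

text \<open>The symmetric arcs are parametrized by the cosine \<open>c\<close> of their endpoints.
  Both endpoints depend injectively on \<open>c\<close>, so only countably many \<open>c\<close> in
  the interval meet an atom.\<close>

lemma exists_small_arc_nonatomic:
  assumes "complex_measure circle_borel \<nu>" "0 < l" "l < u" "u < (1::real)"
  obtains \<eta> I where "circle_arc (- \<eta>) \<eta> I" "\<not> atom \<nu> (circle_exp (- \<eta>))" "\<not> atom \<nu> (circle_exp \<eta>)"
    "\<And>x. circle_exp x \<in> I \<Longrightarrow> l \<le> cos (2 * pi * x)" "\<And>x. u \<le> cos (2 * pi * x) \<Longrightarrow> circle_exp x \<in> I"
proof -
  define B where "B = {z \<in> sphere 0 1. \<nu> {z} \<noteq> 0}"
  have "countable B"
    unfolding B_def using assms(1)
    by (rule countable_singletons_complex_measure) (auto simp: sets_restrict_space)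
  moreover have "inj_on (\<lambda>c. cis (arccos c)) {l<..<u}" "inj_on (\<lambda>c. cis (- arccos c)) {l<..<u}"
    using assms by (auto simp: inj_on_def complex_eq_iff)
  ultimately have "countable ({c \<in> {l<..<u}. cis (arccos c) \<in> B} \<union> {c \<in> {l<..<u}. cis (- arccos c) \<in> B})"
    by (intro countable_Un) (rule countable_image_inj_on[OF countable_subset[of _ B]], auto intro: inj_on_subset)+
  then have "\<not> {l<..<u} \<subseteq> {c \<in> {l<..<u}. cis (arccos c) \<in> B} \<union> {c \<in> {l<..<u}. cis (- arccos c) \<in> B}"
    using uncountable_open_interval[of l u] \<open>l < u\<close> countable_subset by blast
  then obtain c where "c \<in> {l<..<u}"
    "c \<notin> {c \<in> {l<..<u}. cis (arccos c) \<in> B} \<union> {c \<in> {l<..<u}. cis (- arccos c) \<in> B}" by blast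
  then have c: "l < c" "c < u" "cis (arccos c) \<notin> B" "cis (- arccos c) \<notin> B" by auto
  define \<eta> where "\<eta> = arccos c / (2 * pi)"
  have \<eta>: "2 * pi * \<eta> = arccos c" by (simp add: \<eta>_def)
  have arc: "0 < arccos c" "arccos c \<le> pi" "cos (arccos c) = c"
    using c assms arccos_lt_bounded[of c] arccos_bounded[of c] by auto
  let ?I = "circle_exp ` {- \<eta>..\<eta>}"
  show thesis
  proof (rule that[of \<eta> ?I])
    have "0 < \<eta>" "2 * \<eta> \<le> 1" using arc by (auto simp: \<eta>_def)
    then show "circle_arc (- \<eta>) \<eta> ?I"
      unfolding circle_arc_def by (intro conjI exI[of _ "{- \<eta>..\<eta>}"]) auto
    show "\<not> atom \<nu> (circle_exp \<eta>)" "\<not> atom \<nu> (circle_exp (- \<eta>))"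
      using c \<eta> by (auto simp: atom_def circle_exp_eq_cis B_def)
  next
    fix x assume "circle_exp x \<in> ?I"
    then obtain t where "t \<in> {- \<eta>..\<eta>}" and cis_eq: "cis (2 * pi * x) = cis (2 * pi * t)"
      unfolding circle_exp_eq_cis by blast
    then have t: "\<bar>t\<bar> \<le> \<eta>" by auto
    have "2 * pi * \<bar>t\<bar> \<le> 2 * pi * \<eta>" using t by simp
    then have "cos (arccos c) \<le> cos (2 * pi * \<bar>t\<bar>)"
      unfolding \<eta> using arc by (intro cos_monotone_0_pi_le) auto
    also have "cos (2 * pi * \<bar>t\<bar>) = cos (2 * pi * x)"
      using cis_eq cos_abs_real[of "2 * pi * t"] by (simp add: abs_mult complex_eq_iff)
    finally show "l \<le> cos (2 * pi * x)" using arc c by simp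
  next
    fix x assume x: "u \<le> cos (2 * pi * x)"
    \<comment> \<open>The principal argument replaces \<open>2 * pi * x\<close> by a representative
      in [-pi, pi], where the cosine determines the absolute value.\<close>
    define p where "p = Arg (cis (2 * pi * x))"
    have p: "cis p = cis (2 * pi * x)" "\<bar>p\<bar> \<le> pi"
      using cis_Arg[of "cis (2 * pi * x)"] Arg_bounded[of "cis (2 * pi * x)"]
      by (auto simp: p_def sgn_div_norm)
    then have "c < cos \<bar>p\<bar>" using x c by (simp add: complex_eq_iff)
    then have "\<bar>p\<bar> \<le> arccos c"
      using cos_monotone_0_pi[of "arccos c" "\<bar>p\<bar>"] arc p by force
    then have "p / (2 * pi) \<in> {- \<eta>..\<eta>}" by (auto simp: \<eta>_def field_simps)
    moreover have "circle_exp x = circle_exp (p / (2 * pi))" using p by (simp add: circle_exp_eq_cis)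
    ultimately show "circle_exp x \<in> ?I" by blast
  qed
qed

section \<open>Two contradictory frequencies for one arc\<close>

lemma almost_uniformly_distributedE:
  assumes "almost_uniformly_distributed n \<nu> \<theta>" "circle_arc a b I"
    "\<not> atom \<nu> (circle_exp a)" "\<not> atom \<nu> (circle_exp b)"
  obtains N :: "nat \<Rightarrow> nat" where "strict_mono N" "\<forall>j. N j > 0"
    "(\<lambda>j. real (card {k. k \<le> N j \<and> circle_exp (of_int (n k) * \<theta>) \<in> I}) / real (N j)) \<longlonglongrightarrow> Re (\<nu> I)"
proof -
  from assms obtain N :: "nat \<Rightarrow> nat" where N: "strict_mono N" "\<forall>j. N j > 0"
    "(\<lambda>j. of_nat (card {k. k \<le> N j \<and> circle_exp (of_int (n k) * \<theta>) \<in> I}) / of_nat (N j)) \<longlonglongrightarrow> \<nu> I"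
    unfolding almost_uniformly_distributed_def by blast
  from tendsto_Re[OF N(3)] have
    "(\<lambda>j. real (card {k. k \<le> N j \<and> circle_exp (of_int (n k) * \<theta>) \<in> I}) / real (N j)) \<longlonglongrightarrow> Re (\<nu> I)"
    by (simp add: Re_divide_of_nat)
  with N that show thesis by blast
qed

text \<open>A countable set is null and the unit interval has positive measure, so the good points
  outside \<open>W\<close> cannot be exhausted by a null set.\<close>

lemma AE_lebesgue_on_obtain_not_in:
  assumes "AE x in lebesgue_on {0..1::real}. P x" "countable W"
  obtains x where "P x" "x \<notin> W"
proof -
  have "W \<in> null_sets lebesgue"
    using assms(2) by (intro null_sets_completionI countable_imp_null_set_lborel)
  then have "AE x in lebesgue. x \<in> {0..1} \<longrightarrow> x \<notin> W" by (auto dest: AE_not_in)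
  then have "AE x in lebesgue_on {0..1}. x \<notin> W" by (simp add: AE_restrict_space_iff)
  with assms(1) have "AE x in lebesgue_on {0..1}. P x \<and> x \<notin> W" by eventually_elim auto
  moreover have "ae_filter (lebesgue_on {0..1::real}) \<noteq> bot"
    by (simp add: ae_filter_eq_bot_iff emeasure_restrict_space space_restrict_space)
  ultimately show thesis using that eventually_happens' by blast
qed

theorem theorem6p11:
  fixes \<nu> :: "complex set \<Rightarrow> complex"
  assumes "complex_measure circle_borel \<nu>"
    and "Re (fourier_coeff \<nu> 1) < 1 / 2"
  shows "uncountable (exceptional_set furstenberg_seq \<nu>)"
proof
  assume W: "countable (exceptional_set furstenberg_seq \<nu>)"
  obtain \<eta> I where arc: "circle_arc (- \<eta>) \<eta> I" "\<not> atom \<nu> (circle_exp (- \<eta>))" "\<not> atom \<nu> (circle_exp \<eta>)"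
    and lower: "\<And>x. circle_exp x \<in> I \<Longrightarrow> 98 / 100 \<le> cos (2 * pi * x)"
    and upper: "\<And>x. 99 / 100 \<le> cos (2 * pi * x) \<Longrightarrow> circle_exp x \<in> I"
    using exists_small_arc_nonatomic[OF assms(1), of "98 / 100" "99 / 100"] by auto
  let ?V = "\<lambda>\<theta> N. {k. k \<le> N \<and> circle_exp (of_int (furstenberg_seq k) * \<theta>) \<in> I}"
  have "3 / 10 \<le> Re (\<nu> I)"
  proof -
    let ?A = "{\<alpha>. \<forall>N. 3 / 10 * real (N + 1) \<le> card {k. k \<le> N \<and> cos (rotation k \<alpha>) \<ge> 99 / 100}}"
    have "\<not> ?A \<subseteq> exceptional_set furstenberg_seq \<nu>"
      using uncountable_recurrent countable_subset[OF _ W] by blast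
    then obtain \<alpha> where \<alpha>: "almost_uniformly_distributed furstenberg_seq \<nu> \<alpha>"
      and many: "\<And>N. 3 / 10 * real (N + 1) \<le> card {k. k \<le> N \<and> cos (rotation k \<alpha>) \<ge> 99 / 100}"
      unfolding exceptional_set_def by blast
    obtain N where N: "strict_mono N" "\<forall>j. N j > 0" "(\<lambda>j. real (card (?V \<alpha> (N j))) / real (N j)) \<longlonglongrightarrow> Re (\<nu> I)"
      by (rule almost_uniformly_distributedE[OF \<alpha> arc])
    \<comment> \<open>There are \<open>m + 1\<close> indices \<open>k \<le> m\<close> but the
      divisor is \<open>m\<close>, which only helps. Since the bound holds for every positive
      \<open>m\<close>, it passes to the limit along whatever \<open>N\<close> is supplied.\<close>
    have "3 / 10 \<le> real (card (?V \<alpha> m)) / real m" if "m > 0" for m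
    proof -
      have "3 / 10 * real m \<le> 3 / 10 * real (m + 1)" by simp
      also have "\<dots> \<le> card {k. k \<le> m \<and> cos (rotation k \<alpha>) \<ge> 99 / 100}" by (rule many)
      also have "\<dots> \<le> card (?V \<alpha> m)" using upper by (intro of_nat_mono card_mono) auto
      finally show ?thesis using that by (simp add: pos_le_divide_eq)
    qed
    with N show ?thesis by (intro LIMSEQ_le_const[OF N(3)]) auto
  qed
  moreover have "Re (\<nu> I) \<le> 29 / 100"
  proof -
    obtain \<beta> where "\<beta> \<notin> exceptional_set furstenberg_seq \<nu>"
      and few: "\<forall>\<^sub>F N in sequentially. card {k. k \<le> N \<and> cos (rotation k \<beta>) \<ge> 98 / 100} \<le> 29 / 100 * real N"
      by (rule AE_lebesgue_on_obtain_not_in[OF AE_few_visits_near_zero W])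
    then have \<beta>: "almost_uniformly_distributed furstenberg_seq \<nu> \<beta>"
      by (simp add: exceptional_set_def)
    obtain N where N: "strict_mono N" "\<forall>j. N j > 0" "(\<lambda>j. real (card (?V \<beta> (N j))) / real (N j)) \<longlonglongrightarrow> Re (\<nu> I)"
      by (rule almost_uniformly_distributedE[OF \<beta> arc])
    \<comment> \<open>An eventual bound suffices here, because \<open>N j\<close> tends to infinity
      for any strictly increasing \<open>N\<close>.\<close>
    have "\<forall>\<^sub>F j in sequentially. card {k. k \<le> N j \<and> cos (rotation k \<beta>) \<ge> 98 / 100} \<le> 29 / 100 * real (N j)"
      using few filterlim_subseq[OF N(1)] by (rule eventually_compose_filterlim)
    then have "\<forall>\<^sub>F j in sequentially. real (card (?V \<beta> (N j))) / real (N j) \<le> 29 / 100"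
    proof eventually_elim
      case (elim j)
      have "real (card (?V \<beta> (N j))) \<le> card {k. k \<le> N j \<and> cos (rotation k \<beta>) \<ge> 98 / 100}"
        using lower by (intro of_nat_mono card_mono) auto
      also note elim
      finally show ?case using N(2) by (simp add: pos_divide_le_eq)
    qed
    then show ?thesis by (intro tendsto_upperbound[OF N(3)]) auto
  qed
  ultimately show False by simp
qed

end
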